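(* Let $a\in\mathbb{C}$. The projectivization (closure in $\mathbb{CP}^3$) of the contracted monodromy manifold of the degenerate third Painlevé equation $$u''(\tau)=\frac{(u'(\tau))^2}{u(\tau)}-\frac{u'(\tau)}{\tau}+\frac1\tau\left(-8\varepsilon(u(\tau))^2+2ab\right)+\frac{b^2}{u(\tau)}$$ is a singular cubic surface of type $A_3$.
   Context: The contracted monodromy manifold is the algebraic variety in $\mathbb{C}^4$ with coordinates $(\tilde g_1,\tilde g_2,\tilde g_3,\tilde s)$ given by $$\tilde g_1-\tilde g_2+\tilde g_3(1-\tilde s)=\mathrm{e}^{-\pi a},\qquad \tilde g_3(\tilde g_3-1)=-\tilde g_1\tilde g_2 .$$ Eliminating $\tilde g_2$ by the first equation identifies it with the cubic surface in $\mathbb{C}^3$ with coordinates $(\tilde g_1,\tilde g_3,\tilde s)$ $$\tilde g_1\tilde g_3(\tilde s-1)=\tilde g_1^2+\tilde g_3^2-(\tilde g_1\mathrm{e}^{-\pi a}+\tilde g_3),$$ and its projectivization is the cubic surface in $\mathbb{CP}^3$ obtained by homogenizing this equation (up to a projective linear change of coordinates). A cubic surface is of type $A_3$ if its only singular point is a singularity of type $A_3$ (locally analytically equivalent to $xy=w^4$). *)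

theory Defs
  imports "HOL-Analysis.Analysis"
begin

definition proportional :: "complex^4 \<Rightarrow> complex^4 \<Rightarrow> bool" where
  "proportional v w \<longleftrightarrow> v \<noteq> 0 \<and> w \<noteq> 0 \<and> (\<exists>c. w = c *s v)"

lemma part_equivp_proportional: "part_equivp proportional"
proof (rule part_equivpI)
  have "proportional (axis 1 1) (axis 1 1)"
    by (auto simp: proportional_def axis_eq_0_iff intro: exI[of _ 1])
  then show "\<exists>v. proportional v v" ..
  show "symp proportional"
  proof (rule sympI)
    fix v w assume vw: "proportional v w"
    then obtain c where c: "w = c *s v" by (auto simp: proportional_def)
    with vw have "c \<noteq> 0" by (auto simp: proportional_def)
    with c have "v = inverse c *s w" by (simp add: vector_smult_assoc)
    with vw show "proportional w v" by (auto simp: proportional_def)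
  qed
  show "transp proportional"
    by (rule transpI) (auto simp: proportional_def vector_smult_assoc)
qed

text \<open>For \<open>v \<noteq> 0\<close>, \<open>hom_coords v\<close> is the point \<open>[v\<^sub>1 : v\<^sub>2 : v\<^sub>3 : v\<^sub>4]\<close>; the value
  \<open>hom_coords 0\<close> is meaningless.\<close>

quotient_type cp3 = "complex^4" / partial: proportional
  morphisms rep_cp3 hom_coords
  by (rule part_equivp_proportional)

text \<open>The quotient topology from \<open>\<complex>\<^sup>4 - {0}\<close>.\<close>

instantiation cp3 :: topological_space
begin

definition open_cp3 :: "cp3 set \<Rightarrow> bool" where
  "open_cp3 U \<longleftrightarrow> open {v. v \<noteq> 0 \<and> hom_coords v \<in> U}"

instance
proof
  have "{v :: complex^4. v \<noteq> 0} = - {0}" by auto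
  then show "open (UNIV :: cp3 set)" by (simp add: open_cp3_def open_Compl)
next
  fix S T :: "cp3 set" assume "open S" "open T"
  then have "open ({v. v \<noteq> 0 \<and> hom_coords v \<in> S} \<inter> {v. v \<noteq> 0 \<and> hom_coords v \<in> T})"
    unfolding open_cp3_def by (rule open_Int)
  also have "{v. v \<noteq> 0 \<and> hom_coords v \<in> S} \<inter> {v. v \<noteq> 0 \<and> hom_coords v \<in> T}
      = {v. v \<noteq> 0 \<and> hom_coords v \<in> S \<inter> T}" by auto
  finally show "open (S \<inter> T)" by (simp add: open_cp3_def)
next
  fix K :: "cp3 set set" assume "\<forall>S\<in>K. open S"
  then have "open (\<Union>S\<in>K. {v. v \<noteq> 0 \<and> hom_coords v \<in> S})"
    unfolding open_cp3_def by (intro open_UN) auto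
  also have "(\<Union>S\<in>K. {v. v \<noteq> 0 \<and> hom_coords v \<in> S}) = {v. v \<noteq> 0 \<and> hom_coords v \<in> \<Union>K}"
    by auto
  finally show "open (\<Union>K)" by (simp add: open_cp3_def)
qed

end

text \<open>The inverse of the standard chart on the part of projective space where the \<open>i\<close>-th
  homogeneous coordinate does not vanish: it inserts \<open>1\<close> as coordinate number \<open>i\<close>.
  The last branch is \<open>i = 4\<close>.\<close>

definition affine_chart :: "4 \<Rightarrow> complex^3 \<Rightarrow> complex^4" where
  "affine_chart i z =
    (if i = 1 then vector [1, z$1, z$2, z$3]
     else if i = 2 then vector [z$1, 1, z$2, z$3]
     else if i = 3 then vector [z$1, z$2, 1, z$3]
     else vector [z$1, z$2, z$3, 1])"

text \<open>For an algebraic subset of affine space this closure coincides with the Zariski closure.\<close>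

definition projective_closure :: "(complex^3) set \<Rightarrow> cp3 set" where
  "projective_closure X = closure ((\<lambda>z. hom_coords (affine_chart 4 z)) ` X)"

definition holomorphic_fun_on :: "(complex^'n \<Rightarrow> complex) \<Rightarrow> (complex^'n) set \<Rightarrow> bool" where
  "holomorphic_fun_on f U \<longleftrightarrow>
    (\<forall>z\<in>U. \<exists>f'. (f has_derivative f') (at z) \<and> Vector_Spaces.linear (*s) (*) f')"

definition holomorphic_map_on :: "(complex^'n \<Rightarrow> complex^'m) \<Rightarrow> (complex^'n) set \<Rightarrow> bool" where
  "holomorphic_map_on \<phi> U \<longleftrightarrow> (\<forall>i. holomorphic_fun_on (\<lambda>z. \<phi> z $ i) U)"

text \<open>A local biholomorphism carrying \<open>p\<close> to \<open>q\<close> and the ideal generated by \<open>g\<close> to the ideal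
  generated by \<open>f\<close>; that is, an isomorphism of the analytic space germs \<open>(f = 0, p)\<close> and
  \<open>(g = 0, q)\<close> induced by the ambient spaces.\<close>

definition locally_analytically_equivalent ::
    "(complex^'n \<Rightarrow> complex) \<Rightarrow> complex^'n \<Rightarrow> (complex^'n \<Rightarrow> complex) \<Rightarrow> complex^'n \<Rightarrow> bool" where
  "locally_analytically_equivalent f p g q \<longleftrightarrow>
    (\<exists>U V \<phi> \<psi> u. open U \<and> p \<in> U \<and> open V \<and> q \<in> V \<and> \<phi> p = q \<and>
       homeomorphism U V \<phi> \<psi> \<and> holomorphic_map_on \<phi> U \<and> holomorphic_map_on \<psi> V \<and>
       holomorphic_fun_on u U \<and> (\<forall>z\<in>U. u z \<noteq> 0) \<and> (\<forall>z\<in>U. f z = u z * g (\<phi> z)))"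

definition A_singularity :: "nat \<Rightarrow> (complex^3 \<Rightarrow> complex) \<Rightarrow> complex^3 \<Rightarrow> bool" where
  "A_singularity n f p \<longleftrightarrow>
    locally_analytically_equivalent f p (\<lambda>z. z$1 * z$2 - (z$3) ^ (n + 1)) 0"

definition cubic_form :: "(complex^4 \<Rightarrow> complex) \<Rightarrow> bool" where
  "cubic_form F \<longleftrightarrow> (\<exists>A. \<forall>v. F v = (\<Sum>i\<in>UNIV. \<Sum>j\<in>UNIV. \<Sum>k\<in>UNIV. A i j k * v$i * v$j * v$k))"

definition zero_locus :: "(complex^4 \<Rightarrow> complex) \<Rightarrow> cp3 set" where
  "zero_locus F = {hom_coords v | v. v \<noteq> 0 \<and> F v = 0}"

definition partial_deriv :: "4 \<Rightarrow> (complex^4 \<Rightarrow> complex) \<Rightarrow> complex^4 \<Rightarrow> complex" where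
  "partial_deriv i F v = deriv (\<lambda>x. F (v + axis i x)) 0"

definition singular_points :: "(complex^4 \<Rightarrow> complex) \<Rightarrow> cp3 set" where
  "singular_points F =
    {hom_coords v | v. v \<noteq> 0 \<and> F v = 0 \<and> (\<forall>i. partial_deriv i F v = 0)}"

text \<open>The analytic type of the dehomogenized equation does not depend on the chart.\<close>

definition A_singularity_at :: "nat \<Rightarrow> (complex^4 \<Rightarrow> complex) \<Rightarrow> cp3 \<Rightarrow> bool" where
  "A_singularity_at n F P \<longleftrightarrow>
    (\<exists>i z. P = hom_coords (affine_chart i z) \<and> A_singularity n (\<lambda>x. F (affine_chart i x)) z)"

text \<open>A form with a single singular point is squarefree, hence determined up to a scalar by its
  zero locus; so it does not matter that the equation is existentially quantified here.\<close>

definition cubic_surface_of_type_A :: "nat \<Rightarrow> cp3 set \<Rightarrow> bool" where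
  "cubic_surface_of_type_A n S \<longleftrightarrow>
    (\<exists>F. cubic_form F \<and> (\<exists>v. F v \<noteq> 0) \<and> S = zero_locus F \<and>
       (\<exists>P. singular_points F = {P} \<and> A_singularity_at n F P))"

text \<open>Coordinates \<open>g$1, g$2, g$3, g$4\<close> stand for \<open>g\<^sub>1, g\<^sub>2, g\<^sub>3, s\<close> (all with tildes).
  The manifold attached to the degenerate third Painleve equation
  \<open>u'' = u'\<^sup>2/u - u'/\<tau> + (-8 \<epsilon> u\<^sup>2 + 2 a b)/\<tau> + b\<^sup>2/u\<close>
  depends on its parameter \<open>a\<close>, but not on \<open>\<epsilon>\<close> and \<open>b\<close>.\<close>

definition contracted_monodromy_manifold :: "complex \<Rightarrow> (complex^4) set" where
  "contracted_monodromy_manifold a =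
    {g. g$1 - g$2 + g$3 * (1 - g$4) = exp (- (of_real pi * a)) \<and>
        g$3 * (g$3 - 1) = - (g$1 * g$2)}"

text \<open>The first equation expresses \<open>g$2\<close> through the other coordinates, so forgetting \<open>g$2\<close>
  maps the manifold bijectively onto a cubic surface in \<open>\<complex>\<^sup>3\<close>.\<close>

definition eliminate_g2 :: "complex^4 \<Rightarrow> complex^3" where
  "eliminate_g2 g = vector [g$1, g$3, g$4]"

definition projectivization :: "complex \<Rightarrow> cp3 set" where
  "projectivization a = projective_closure (eliminate_g2 ` contracted_monodromy_manifold a)"

end

theory Submission
  imports Defs
begin

text \<open>With \<open>c = exp (- \<pi> a) \<noteq> 0\<close> and coordinates \<open>[x : y : s : w]\<close> the surface is
  \<open>w (x\<^sup>2 + x y + y\<^sup>2) - x y s - w\<^sup>2 (c x + y) = 0\<close>. The equation is linear in \<open>s\<close>, which makes it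
  easy to approach its points at infinity by affine ones; its gradient vanishes only at
  \<open>[0 : 0 : 1 : 0]\<close>. There, for \<open>s = 1\<close>, the cubic is quadratic in \<open>(x, y)\<close> with coefficients depending
  on \<open>w\<close>: completing the square leaves the critical value \<open>h(w) w\<^sup>4\<close> with \<open>h(0) = c\<close>, and the quadratic
  part has discriminant \<open>(1 - 3 w) (1 + w)\<close>, so square roots that are holomorphic near \<open>w = 0\<close>
  split it into two linear factors. Dividing one of them by \<open>h\<close> gives the normal form up to the unit
  \<open>- h\<close>, by a coordinate change that fixes \<open>w\<close> and is affine, hence explicitly invertible, in
  \<open>(x, y)\<close>.\<close>

section \<open>Holomorphic functions of several variables\<close>

lemma holomorphic_fun_onE:
  assumes "holomorphic_fun_on f U" "z \<in> U"
  obtains f' where "(f has_derivative f') (at z)" "\<And>x y. f' (x + y) = f' x + f' y"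
    "\<And>k x. f' (k *s x) = k * f' x"
  using assms unfolding holomorphic_fun_on_def Vector_Spaces.linear_iff by blast

text \<open>\<open>Vector_Spaces.linear\<close> includes the vector space axioms of both sides. With
  these supplied, complex linearity of a derivative is just additivity and homogeneity.\<close>

lemma vector_space_complex_vec: "vector_space ((*s) :: complex \<Rightarrow> complex^'n \<Rightarrow> complex^'n)"
  by unfold_locales (auto simp: vector_space_over_itself.vector_space_axioms algebra_simps vec_eq_iff)

lemma holomorphic_fun_onI:
  assumes "\<And>z. z \<in> U \<Longrightarrow> \<exists>f'. (f has_derivative f') (at z) \<and> (\<forall>x y. f' (x + y) = f' x + f' y)
    \<and> (\<forall>k x. f' (k *s x) = k * f' x)"
  shows "holomorphic_fun_on f U"
  using assms vector_space_complex_vec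
    vector_space_over_itself.vector_space_axioms
  unfolding holomorphic_fun_on_def Vector_Spaces.linear_iff by blast

lemma holomorphic_fun_on_const: "holomorphic_fun_on (\<lambda>z. k) U"
  by (rule holomorphic_fun_onI) (auto intro!: exI[of _ "\<lambda>_. 0"])

lemma holomorphic_fun_on_nth: "holomorphic_fun_on (\<lambda>z. z $ i) U"
proof (rule holomorphic_fun_onI)
  fix z :: "complex^'a"
  have "((\<lambda>z. z $ i) has_derivative (\<lambda>h. h $ i)) (at z)"
    by (rule bounded_linear_imp_has_derivative) (rule bounded_linear_vec_nth)
  then show "\<exists>f'. ((\<lambda>z. z $ i) has_derivative f') (at z) \<and> (\<forall>x y. f' (x + y) = f' x + f' y)
    \<and> (\<forall>k x. f' (k *s x) = k * f' x)"
    by force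
qed

lemma holomorphic_fun_on_add:
  assumes "holomorphic_fun_on f U" "holomorphic_fun_on g U"
  shows "holomorphic_fun_on (\<lambda>z. f z + g z) U"
proof (rule holomorphic_fun_onI)
  fix z assume z: "z \<in> U"
  obtain f' where f': "(f has_derivative f') (at z)" "\<And>x y. f' (x + y) = f' x + f' y"
    "\<And>k x. f' (k *s x) = k * f' x"
    using holomorphic_fun_onE[OF assms(1) z] by blast
  obtain g' where g': "(g has_derivative g') (at z)" "\<And>x y. g' (x + y) = g' x + g' y"
    "\<And>k x. g' (k *s x) = k * g' x"
    using holomorphic_fun_onE[OF assms(2) z] by blast
  show "\<exists>f'. ((\<lambda>z. f z + g z) has_derivative f') (at z) \<and> (\<forall>x y. f' (x + y) = f' x + f' y)
    \<and> (\<forall>k x. f' (k *s x) = k * f' x)"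
    using has_derivative_add[OF f'(1) g'(1)] f'(2,3) g'(2,3)
    by (intro exI[of _ "\<lambda>h. f' h + g' h"]) (auto simp: algebra_simps)
qed

lemma holomorphic_fun_on_mult:
  assumes "holomorphic_fun_on f U" "holomorphic_fun_on g U"
  shows "holomorphic_fun_on (\<lambda>z. f z * g z) U"
proof (rule holomorphic_fun_onI)
  fix z assume z: "z \<in> U"
  obtain f' where f': "(f has_derivative f') (at z)" "\<And>x y. f' (x + y) = f' x + f' y"
    "\<And>k x. f' (k *s x) = k * f' x"
    using holomorphic_fun_onE[OF assms(1) z] by blast
  obtain g' where g': "(g has_derivative g') (at z)" "\<And>x y. g' (x + y) = g' x + g' y"
    "\<And>k x. g' (k *s x) = k * g' x"
    using holomorphic_fun_onE[OF assms(2) z] by blast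
  show "\<exists>f'. ((\<lambda>z. f z * g z) has_derivative f') (at z) \<and> (\<forall>x y. f' (x + y) = f' x + f' y)
    \<and> (\<forall>k x. f' (k *s x) = k * f' x)"
    using has_derivative_mult[OF f'(1) g'(1)] f'(2,3) g'(2,3)
    by (intro exI[of _ "\<lambda>h. f z * g' h + f' h * g z"]) (auto simp: algebra_simps)
qed

text \<open>The chain rule with a one-variable outer function; it serves for \<open>inverse\<close>
  and \<open>csqrt\<close>.\<close>

lemma holomorphic_fun_on_compose:
  assumes "holomorphic_fun_on f U"
    and "\<And>z. z \<in> U \<Longrightarrow> G field_differentiable at (f z)"
  shows "holomorphic_fun_on (\<lambda>z. G (f z)) U"
proof (rule holomorphic_fun_onI)
  fix z assume z: "z \<in> U"
  obtain f' where f': "(f has_derivative f') (at z)" "\<And>x y. f' (x + y) = f' x + f' y"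
    "\<And>k x. f' (k *s x) = k * f' x"
    using holomorphic_fun_onE[OF assms(1) z] by blast
  obtain D where "(G has_derivative (*) D) (at (f z))"
    using assms(2)[OF z] unfolding field_differentiable_def has_field_derivative_def by blast
  from has_derivative_compose[OF f'(1) this]
  show "\<exists>f'. ((\<lambda>z. G (f z)) has_derivative f') (at z) \<and> (\<forall>x y. f' (x + y) = f' x + f' y)
    \<and> (\<forall>k x. f' (k *s x) = k * f' x)"
    using f'(2,3) by (intro exI[of _ "\<lambda>h. D * f' h"]) (auto simp: algebra_simps)
qed

lemma holomorphic_fun_on_minus:
  assumes "holomorphic_fun_on f U"
  shows "holomorphic_fun_on (\<lambda>z. - f z) U"
  using holomorphic_fun_on_mult[OF holomorphic_fun_on_const[of "-1"] assms] by simp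

lemma holomorphic_fun_on_diff:
  assumes "holomorphic_fun_on f U" "holomorphic_fun_on g U"
  shows "holomorphic_fun_on (\<lambda>z. f z - g z) U"
  using holomorphic_fun_on_add[OF assms(1) holomorphic_fun_on_minus[OF assms(2)]] by simp

lemma holomorphic_fun_on_power:
  "holomorphic_fun_on f U \<Longrightarrow> holomorphic_fun_on (\<lambda>z. f z ^ n) U"
  by (induction n) (simp_all add: holomorphic_fun_on_const holomorphic_fun_on_mult)

lemma holomorphic_fun_on_divide:
  assumes "holomorphic_fun_on f U" "holomorphic_fun_on g U" "\<And>z. z \<in> U \<Longrightarrow> g z \<noteq> 0"
  shows "holomorphic_fun_on (\<lambda>z. f z / g z) U"
proof -
  have "holomorphic_fun_on (\<lambda>z. inverse (g z)) U"
    using assms(3)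
    by (intro holomorphic_fun_on_compose[OF assms(2), of inverse] field_differentiable_inverse
        field_differentiable_ident)
  from holomorphic_fun_on_mult[OF assms(1) this] show ?thesis by (simp add: divide_inverse)
qed

text \<open>A positive real part keeps \<open>f\<close> off the branch cut, the nonpositive real
  axis.\<close>

lemma holomorphic_fun_on_csqrt:
  assumes "holomorphic_fun_on f U" "\<And>z. z \<in> U \<Longrightarrow> Re (f z) > 0"
  shows "holomorphic_fun_on (\<lambda>z. csqrt (f z)) U"
proof (rule holomorphic_fun_on_compose[OF assms(1)])
  fix z assume "z \<in> U"
  with assms(2) have "f z \<notin> \<real>\<^sub>\<le>\<^sub>0" by (force simp: complex_nonpos_Reals_iff)
  then show "csqrt field_differentiable at (f z)" by (rule field_differentiable_at_csqrt)
qed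

lemmas holomorphic_fun_on_intros = holomorphic_fun_on_const holomorphic_fun_on_nth
  holomorphic_fun_on_add holomorphic_fun_on_diff holomorphic_fun_on_minus holomorphic_fun_on_mult
  holomorphic_fun_on_power holomorphic_fun_on_divide holomorphic_fun_on_csqrt

lemma holomorphic_map_on_imp_continuous_on:
  assumes "holomorphic_map_on \<phi> U"
  shows "continuous_on U \<phi>"
proof -
  have "continuous_on U (\<lambda>z. \<phi> z $ i)" for i
    using assms unfolding holomorphic_map_on_def holomorphic_fun_on_def
    by (blast intro: continuous_at_imp_continuous_on has_derivative_continuous)
  then have "continuous_on U (\<lambda>z. \<chi> i. \<phi> z $ i)" by (rule continuous_on_vec_lambda)
  then show ?thesis by (simp add: vec_nth_inverse)
qed

section \<open>Points and curves in projective space\<close>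

lemma hom_coords_eq_iff:
  assumes "v \<noteq> 0" "w \<noteq> 0"
  shows "hom_coords v = hom_coords w \<longleftrightarrow> (\<exists>k. w = k *s v)"
proof -
  have "proportional v v" "proportional w w"
    using assms by (auto simp: proportional_def intro!: exI[of _ 1])
  then have "hom_coords v = hom_coords w \<longleftrightarrow> proportional v w"
    using Quotient_rel[OF Quotient_cp3, of v w] by simp
  then show ?thesis using assms by (simp add: proportional_def)
qed

text \<open>In the quotient topology an open set has an open preimage in the nonzero vectors, so
  convergence of representatives to a nonzero vector passes to the points.\<close>

lemma tendsto_hom_coords:
  assumes "(g \<longlongrightarrow> v) F" "v \<noteq> 0"
  shows "((\<lambda>x. hom_coords (g x)) \<longlongrightarrow> hom_coords v) F"
proof (rule topological_tendstoI)
  fix S assume "open S" "hom_coords v \<in> S"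
  then have "open {v. v \<noteq> 0 \<and> hom_coords v \<in> S}" "v \<in> {v. v \<noteq> 0 \<and> hom_coords v \<in> S}"
    using assms by (auto simp: open_cp3_def)
  from topological_tendstoD[OF assms(1) this]
  show "\<forall>\<^sub>F x in F. hom_coords (g x) \<in> S" by eventually_elim simp
qed

text \<open>The curve need only run in \<open>closure A\<close>, so limits can be iterated: a point
  may be approached by points that are themselves only known as limits.\<close>

lemma hom_coords_in_closure_curve:
  fixes g :: "complex \<Rightarrow> complex^4"
  assumes "\<forall>i. continuous (at 0) (\<lambda>t. g t $ i)" "g 0 \<noteq> 0"
    and "\<And>t. t \<noteq> 0 \<Longrightarrow> hom_coords (g t) \<in> closure A"
  shows "hom_coords (g 0) \<in> closure A"
proof (rule Lim_in_closed_set[OF closed_closure])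
  have "(g \<longlongrightarrow> g 0) (at 0)"
    using assms(1) by (intro vec_tendstoI) (simp add: continuous_at)
  then show "((\<lambda>t. hom_coords (g t)) \<longlongrightarrow> hom_coords (g 0)) (at 0)"
    using assms(2) by (rule tendsto_hom_coords)
  show "\<forall>\<^sub>F t in at 0. hom_coords (g t) \<in> closure A"
    using assms(3) by (auto simp: eventually_at_filter)
qed simp

section \<open>Zero loci of homogeneous functions\<close>

lemma hom_coords_in_zero_locus_iff:
  assumes "\<And>k v. F (k *s v) = k ^ n * F v" "v \<noteq> 0"
  shows "hom_coords v \<in> zero_locus F \<longleftrightarrow> F v = 0"
  using assms by (auto simp: zero_locus_def hom_coords_eq_iff)

text \<open>By homogeneity the preimage of the complement is the set of nonzero vectors with
  \<open>F v \<noteq> 0\<close>, which is open.\<close>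

lemma closed_zero_locus:
  assumes "\<And>k v. F (k *s v) = k ^ n * F v" "continuous_on UNIV F"
  shows "closed (zero_locus F)"
proof -
  have "{v. v \<noteq> 0 \<and> hom_coords v \<in> - zero_locus F} = {v. v \<noteq> 0 \<and> F v \<noteq> 0}"
    using hom_coords_in_zero_locus_iff[OF assms(1)] by auto
  moreover have "open {v. v \<noteq> 0 \<and> F v \<noteq> 0}"
    using assms(2) by (intro open_Collect_conj open_Collect_neq continuous_intros)
  ultimately show ?thesis by (simp add: closed_def open_cp3_def)
qed

lemma vector_4 [simp]:
  "(vector [w, x, y, z] :: 'a::zero^4) $ 1 = w"
  "(vector [w, x, y, z] :: 'a::zero^4) $ 2 = x"
  "(vector [w, x, y, z] :: 'a::zero^4) $ 3 = y"
  "(vector [w, x, y, z] :: 'a::zero^4) $ 4 = z"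
  by (simp_all add: vector_def)

lemma vec4_eq_iff:
  "(v :: 'a^4) = w \<longleftrightarrow> v$1 = w$1 \<and> v$2 = w$2 \<and> v$3 = w$3 \<and> v$4 = w$4"
  by (simp add: vec_eq_iff forall_4)

lemma vec3_eq_iff: "(v :: 'a^3) = w \<longleftrightarrow> v$1 = w$1 \<and> v$2 = w$2 \<and> v$3 = w$3"
  by (simp add: vec_eq_iff forall_3)

section \<open>The homogenized cubic\<close>

text \<open>\<open>v$1\<close>, \<open>v$2\<close>, \<open>v$3\<close> homogenize g1, g3, s, and
  \<open>v$4 = 0\<close> is the plane at infinity. The mixed term \<open>v$4 * v$1 * v$2\<close>
  comes from the -1 in s - 1.\<close>

definition hom_cubic :: "complex \<Rightarrow> complex^4 \<Rightarrow> complex" where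
  "hom_cubic c v = v$4 * ((v$1)\<^sup>2 + v$1 * v$2 + (v$2)\<^sup>2) - v$1 * v$2 * v$3
    - (v$4)\<^sup>2 * (c * v$1 + v$2)"

text \<open>The triple sum collapses because the coefficient array has its only possibly nonzero
  entry at \<open>(a, b, c)\<close>.\<close>

lemma cubic_form_monomial: "cubic_form (\<lambda>v. k * v$a * v$b * v$c)"
proof -
  define A where "A = (\<lambda>i j l. if i = a \<and> j = b \<and> l = c then k else 0)"
  have "k * v$a * v$b * v$c = (\<Sum>i\<in>UNIV. \<Sum>j\<in>UNIV. \<Sum>l\<in>UNIV. A i j l * v$i * v$j * v$l)"
    for v :: "complex^4"
  proof -
    have "(\<Sum>l\<in>UNIV. A i j l * v$i * v$j * v$l) =
        (if j = b then if i = a then k * v$a * v$b * v$c else 0 else 0)" for i j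
    proof -
      have "A i j l * v$i * v$j * v$l =
          (if l = c then if j = b then if i = a then k * v$a * v$b * v$c else 0 else 0 else 0)" for l
        by (simp add: A_def)
      then show ?thesis by simp
    qed
    then show ?thesis by simp
  qed
  then show ?thesis unfolding cubic_form_def by (intro exI[of _ A]) simp
qed

lemma cubic_form_add:
  assumes "cubic_form F" "cubic_form G"
  shows "cubic_form (\<lambda>v. F v + G v)"
proof -
  obtain A B where
    "\<forall>v. F v = (\<Sum>i\<in>UNIV. \<Sum>j\<in>UNIV. \<Sum>k\<in>UNIV. A i j k * v$i * v$j * v$k)"
    "\<forall>v. G v = (\<Sum>i\<in>UNIV. \<Sum>j\<in>UNIV. \<Sum>k\<in>UNIV. B i j k * v$i * v$j * v$k)"
    using assms unfolding cubic_form_def by blast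
  then have "\<forall>v. F v + G v = (\<Sum>i\<in>UNIV. \<Sum>j\<in>UNIV. \<Sum>k\<in>UNIV.
      (A i j k + B i j k) * v$i * v$j * v$k)"
    by (simp add: sum.distrib distrib_right)
  then show ?thesis unfolding cubic_form_def
    by (intro exI[of _ "\<lambda>i j k. A i j k + B i j k"])
qed

lemma cubic_form_hom_cubic: "cubic_form (hom_cubic c)"
proof -
  have "hom_cubic c = (\<lambda>v. 1 * v$4 * v$1 * v$1 + 1 * v$4 * v$1 * v$2 + 1 * v$4 * v$2 * v$2
      + (-1) * v$1 * v$2 * v$3 + (-c) * v$4 * v$4 * v$1 + (-1) * v$4 * v$4 * v$2)"
    by (rule ext) (simp add: hom_cubic_def power2_eq_square algebra_simps)
  then show ?thesis by (simp only: cubic_form_add cubic_form_monomial)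
qed

lemma hom_cubic_scale: "hom_cubic c (k *s v) = k ^ 3 * hom_cubic c v"
  by (simp add: hom_cubic_def algebra_simps power2_eq_square power3_eq_cube)

lemma continuous_on_hom_cubic: "continuous_on UNIV (hom_cubic c)"
  unfolding hom_cubic_def by (intro continuous_intros)

section \<open>Gradient and singular locus of the cubic\<close>

lemma partial_deriv_hom_cubic:
  "partial_deriv 1 (hom_cubic c) v = v$4 * (2 * v$1 + v$2) - v$2 * v$3 - c * (v$4)\<^sup>2"
  "partial_deriv 2 (hom_cubic c) v = v$4 * (v$1 + 2 * v$2) - v$1 * v$3 - (v$4)\<^sup>2"
  "partial_deriv 3 (hom_cubic c) v = - (v$1 * v$2)"
  "partial_deriv 4 (hom_cubic c) v =
    (v$1)\<^sup>2 + v$1 * v$2 + (v$2)\<^sup>2 - 2 * v$4 * (c * v$1 + v$2)"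
  unfolding partial_deriv_def hom_cubic_def vector_add_component axis_def vec_lambda_beta
  by (rule DERIV_imp_deriv, simp,
      (auto intro!: derivative_eq_intros simp: power2_eq_square algebra_simps)[1])+

text \<open>The third derivative forces \<open>v$1 * v$2 = 0\<close>. On each of these planes the
  fourth derivative factors, and on every branch one of the first two becomes a nonzero multiple of
  \<open>(v$4)\<^sup>2\<close>, since \<open>c \<noteq> 0\<close>.\<close>

lemma singular_points_hom_cubic:
  assumes "c \<noteq> 0"
  shows "singular_points (hom_cubic c) = {hom_coords (axis 3 1)}"
proof -
  have only: "hom_coords v = hom_coords (axis 3 1)"
    if "v \<noteq> 0" and D: "\<And>i. partial_deriv i (hom_cubic c) v = 0" for v
  proof -
    note d = D[of 1] D[of 2] D[of 3] D[of 4]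
    have "v$1 = 0 \<and> v$2 = 0 \<and> v$4 = 0"
    proof (cases "v$1 = 0")
      case True
      then have "v$2 * (v$2 - 2 * v$4) = 0"
        using d(4) by (simp add: partial_deriv_hom_cubic power2_eq_square algebra_simps)
      then consider "v$2 = 0" | "v$2 = 2 * v$4" by auto
      then show ?thesis
        using True d assms
        by cases (auto simp: partial_deriv_hom_cubic power2_eq_square algebra_simps)
    next
      case False
      then have y: "v$2 = 0" using d(3) by (simp add: partial_deriv_hom_cubic)
      with False d(4) have x: "v$1 = 2 * c * v$4"
        by (simp add: partial_deriv_hom_cubic power2_eq_square)
      \<comment> \<open>Now \<open>v$4 = 0\<close>, hence \<open>v$1 = 2 * c * v$4 = 0\<close>: this
        case is in fact void.\<close>
      with y d(1) have "3 * c * (v$4)\<^sup>2 = 0"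
        by (simp add: partial_deriv_hom_cubic power2_eq_square algebra_simps)
      then show ?thesis using assms x y by simp
    qed
    then have "axis 3 1 = inverse (v$3) *s v"
      using \<open>v \<noteq> 0\<close> by (auto simp: vec4_eq_iff axis_def)
    then show ?thesis using \<open>v \<noteq> 0\<close> by (subst hom_coords_eq_iff) (auto simp: axis_eq_0_iff)
  qed
  have "(\<forall>i. partial_deriv i (hom_cubic c) (axis 3 1) = 0) \<and> hom_cubic c (axis 3 1) = 0"
    by (simp add: forall_4 partial_deriv_hom_cubic axis_def hom_cubic_def)
  then have "hom_coords (axis 3 1) \<in> singular_points (hom_cubic c)"
    unfolding singular_points_def by (auto simp: axis_eq_0_iff)
  moreover have "singular_points (hom_cubic c) \<subseteq> {hom_coords (axis 3 1)}"
    unfolding singular_points_def using only by blast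
  ultimately show ?thesis by blast
qed

section \<open>The projectivization is the zero locus\<close>

lemma eliminate_g2_image:
  "eliminate_g2 ` contracted_monodromy_manifold a =
    {z. hom_cubic (exp (- (of_real pi * a))) (affine_chart 4 z) = 0}"
proof -
  define c where "c = exp (- (of_real pi * a))"
  have "z \<in> eliminate_g2 ` contracted_monodromy_manifold a"
    if z: "hom_cubic c (affine_chart 4 z) = 0" for z
  proof (rule image_eqI)
    \<comment> \<open>The second entry is g2 as determined by the first equation; the second
      equation then becomes the affine cubic.\<close>
    let ?g = "vector [z$1, z$1 + z$2 * (1 - z$3) - c, z$2, z$3] :: complex^4"
    show "z = eliminate_g2 ?g" by (simp add: eliminate_g2_def vec3_eq_iff)
    have "z$2 * (z$2 - 1) = - (z$1 * (z$1 + z$2 * (1 - z$3) - c))"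
      using z unfolding hom_cubic_def affine_chart_def by simp algebra
    then show "?g \<in> contracted_monodromy_manifold a"
      by (simp add: contracted_monodromy_manifold_def c_def)
  qed
  moreover have "hom_cubic c (affine_chart 4 (eliminate_g2 g)) = 0"
    if "g \<in> contracted_monodromy_manifold a" for g
  proof -
    have "g$2 = g$1 + g$3 * (1 - g$4) - c" "g$3 * (g$3 - 1) = - (g$1 * g$2)"
      using that by (simp_all add: contracted_monodromy_manifold_def c_def algebra_simps)
    then have "g$3 * (g$3 - 1) = - (g$1 * (g$1 + g$3 * (1 - g$4) - c))" by simp
    then show ?thesis
      by (simp add: hom_cubic_def affine_chart_def eliminate_g2_def power2_eq_square algebra_simps)
  qed
  ultimately show ?thesis unfolding c_def by blast
qed

lemma hom_coords_in_affine_part: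
  assumes "hom_cubic c v = 0" "v$4 \<noteq> 0"
  shows "hom_coords v \<in> (\<lambda>z. hom_coords (affine_chart 4 z)) ` {z. hom_cubic c (affine_chart 4 z) = 0}"
proof (rule image_eqI)
  let ?z = "vector [v$1 / v$4, v$2 / v$4, v$3 / v$4] :: complex^3"
  have eq: "affine_chart 4 ?z = inverse (v$4) *s v"
    using assms(2) by (simp add: affine_chart_def vec4_eq_iff divide_inverse)
  have "v \<noteq> 0" using assms(2) by auto
  then show "hom_coords v = hom_coords (affine_chart 4 ?z)"
    unfolding eq using assms(2) by (subst hom_coords_eq_iff) auto
  show "?z \<in> {z. hom_cubic c (affine_chart 4 z) = 0}"
    by (simp add: eq hom_cubic_scale assms(1))
qed

text \<open>Away from the plane at infinity the equation is solved for the third coordinate. A point at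
  infinity is the limit of such solutions along a curve whose parameter is the fourth coordinate;
  on the lines \<open>v\<^sub>1 = v\<^sub>4 = 0\<close> and \<open>v\<^sub>2 = v\<^sub>4 = 0\<close> the vanishing coordinate
  must go to zero at the speed that produces the required value of the third one.\<close>

lemma zero_locus_hom_cubic:
  "zero_locus (hom_cubic c) = projective_closure {z. hom_cubic c (affine_chart 4 z) = 0}"
proof
  let ?A = "(\<lambda>z. hom_coords (affine_chart 4 z)) ` {z. hom_cubic c (affine_chart 4 z) = 0}"
  have "affine_chart 4 z \<noteq> 0" for z by (simp add: affine_chart_def vec4_eq_iff)
  then have "?A \<subseteq> zero_locus (hom_cubic c)" unfolding zero_locus_def by blast
  then show "projective_closure {z. hom_cubic c (affine_chart 4 z) = 0} \<subseteq> zero_locus (hom_cubic c)"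
    unfolding projective_closure_def
    by (rule closure_minimal) (rule closed_zero_locus[OF hom_cubic_scale continuous_on_hom_cubic])
  have aff: "hom_coords v \<in> closure ?A" if "hom_cubic c v = 0" "v$4 \<noteq> 0" for v
    by (rule subsetD[OF closure_subset hom_coords_in_affine_part[OF that]])
  have curve: "hom_coords v \<in> closure ?A"
    if "\<forall>i. continuous (at 0) (\<lambda>t. g t $ i)" "g 0 = v" "v \<noteq> 0"
      "\<And>t. t \<noteq> 0 \<Longrightarrow> hom_coords (g t) \<in> closure ?A" for v and g :: "complex \<Rightarrow> complex^4"
  proof -
    have "g 0 \<noteq> 0" using that(2,3) by simp
    from hom_coords_in_closure_curve[of g ?A, OF that(1) this that(4)] that(2) show ?thesis by simp
  qed
  have line1: "hom_coords v \<in> closure ?A"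
    if v: "v \<noteq> 0" "v$1 = 0" "v$4 = 0" "v$2 \<noteq> 0" "v$3 \<noteq> 0" for v
  proof -
    \<comment> \<open>On x = m t, w = t a factor t cancels from the equation, so its solution
      \<open>?s\<close> is continuous at 0. There its value is \<open>v$2 / m\<close>, which
      dictates \<open>m\<close>.\<close>
    define m where "m = v$2 / v$3"
    have m: "m \<noteq> 0" using v by (simp add: m_def)
    let ?s = "\<lambda>t. (m\<^sup>2 * t\<^sup>2 + m * t * v$2 + (v$2)\<^sup>2 - t * (c * m * t + v$2)) / (m * v$2)"
    let ?g = "\<lambda>t. vector [m * t, v$2, ?s t, t] :: complex^4"
    show ?thesis
    proof (rule curve[of ?g, OF _ _ v(1)])
      show "\<forall>i. continuous (at 0) (\<lambda>t. ?g t $ i)"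
        unfolding forall_4 vector_4 by (intro conjI continuous_intros) (use m v in auto)
      show "?g 0 = v" using v by (simp add: vec4_eq_iff m_def power2_eq_square)
      show "hom_coords (?g t) \<in> closure ?A" if "t \<noteq> 0" for t
        using that m v by (intro aff) (simp_all add: hom_cubic_def field_simps power2_eq_square)
    qed
  qed
  have line2: "hom_coords v \<in> closure ?A"
    if v: "v \<noteq> 0" "v$2 = 0" "v$4 = 0" "v$1 \<noteq> 0" "v$3 \<noteq> 0" for v
  proof -
    \<comment> \<open>The same with the first two coordinates exchanged:
      \<open>?s 0 = v$1 / m\<close>.\<close>
    define m where "m = v$1 / v$3"
    have m: "m \<noteq> 0" using v by (simp add: m_def)
    let ?s = "\<lambda>t. (m\<^sup>2 * t\<^sup>2 + m * t * v$1 + (v$1)\<^sup>2 - t * (c * v$1 + m * t)) / (m * v$1)"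
    let ?g = "\<lambda>t. vector [v$1, m * t, ?s t, t] :: complex^4"
    show ?thesis
    proof (rule curve[of ?g, OF _ _ v(1)])
      show "\<forall>i. continuous (at 0) (\<lambda>t. ?g t $ i)"
        unfolding forall_4 vector_4 by (intro conjI continuous_intros) (use m v in auto)
      show "?g 0 = v" using v by (simp add: vec4_eq_iff m_def power2_eq_square)
      show "hom_coords (?g t) \<in> closure ?A" if "t \<noteq> 0" for t
        using that m v by (intro aff) (simp_all add: hom_cubic_def field_simps power2_eq_square)
    qed
  qed
  have line3: "hom_coords v \<in> closure ?A"
    if v: "v \<noteq> 0" "v$3 = 0" "v$4 = 0" "v$1 \<noteq> 0" "v$2 \<noteq> 0" for v
  proof -
    \<comment> \<open>Here xy stays nonzero at t = 0, so no factor cancels and the solution tends to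
      0, the required third coordinate.\<close>
    let ?s = "\<lambda>t. (t * ((v$1)\<^sup>2 + v$1 * v$2 + (v$2)\<^sup>2) - t\<^sup>2 * (c * v$1 + v$2)) / (v$1 * v$2)"
    let ?g = "\<lambda>t. vector [v$1, v$2, ?s t, t] :: complex^4"
    show ?thesis
    proof (rule curve[of ?g, OF _ _ v(1)])
      show "\<forall>i. continuous (at 0) (\<lambda>t. ?g t $ i)"
        unfolding forall_4 vector_4 by (intro conjI continuous_intros) (use v in auto)
      show "?g 0 = v" using v by (simp add: vec4_eq_iff)
      show "hom_coords (?g t) \<in> closure ?A" if "t \<noteq> 0" for t
        using that v by (intro aff) (simp_all add: hom_cubic_def field_simps power2_eq_square)
    qed
  qed
  have line1': "hom_coords v \<in> closure ?A" if v: "v \<noteq> 0" "v$1 = 0" "v$4 = 0" "v$3 \<noteq> 0" for v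
  proof (cases "v$2 = 0")
    case True
    \<comment> \<open>This is the point [0 : 0 : 1 : 0], a limit of points already handled by
      \<open>line1\<close>.\<close>
    let ?g = "\<lambda>t. vector [0, t, v$3, 0] :: complex^4"
    show ?thesis
    proof (rule curve[of ?g, OF _ _ v(1)])
      show "\<forall>i. continuous (at 0) (\<lambda>t. ?g t $ i)"
        unfolding forall_4 vector_4 by (intro conjI continuous_intros)
      show "?g 0 = v" using v True by (simp add: vec4_eq_iff)
      show "hom_coords (?g t) \<in> closure ?A" if "t \<noteq> 0" for t
        using that v by (intro line1) (simp_all add: vec4_eq_iff)
    qed
  qed (use v line1 in blast)
  have coordinate_point: "hom_coords v \<in> closure ?A"
    if v: "v \<noteq> 0" "v$3 = 0" "v$4 = 0" "v$1 = 0 \<or> v$2 = 0" for v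
  proof -
    \<comment> \<open>The remaining two vertices are approached inside the plane at infinity, along
      a line already covered.\<close>
    let ?g = "\<lambda>t. vector [v$1, v$2, t, 0] :: complex^4"
    show ?thesis
    proof (rule curve[of ?g, OF _ _ v(1)])
      show "\<forall>i. continuous (at 0) (\<lambda>t. ?g t $ i)"
        unfolding forall_4 vector_4 by (intro conjI continuous_intros)
      show "?g 0 = v" using v by (simp add: vec4_eq_iff)
      show "hom_coords (?g t) \<in> closure ?A" if "t \<noteq> 0" for t
      proof (cases "v$1 = 0")
        case True
        then show ?thesis using that v by (intro line1') (simp_all add: vec4_eq_iff)
      next
        case False
        then show ?thesis using that v by (intro line2) (simp_all add: vec4_eq_iff)
      qed
    qed
  qed
  have "hom_coords v \<in> closure ?A" if v: "v \<noteq> 0" "hom_cubic c v = 0" for v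
  proof (cases "v$4 = 0")
    case True
    \<comment> \<open>The plane at infinity cuts the cubic in a triangle of coordinate
      lines.\<close>
    with v(2) have "v$1 * v$2 * v$3 = 0" by (simp add: hom_cubic_def)
    then consider "v$3 = 0" "v$1 = 0 \<or> v$2 = 0" | "v$1 = 0" "v$3 \<noteq> 0"
      | "v$2 = 0" "v$1 \<noteq> 0" "v$3 \<noteq> 0" | "v$3 = 0" "v$1 \<noteq> 0" "v$2 \<noteq> 0" by auto
    then show ?thesis
    proof cases
      case 1 then show ?thesis using True v(1) by (intro coordinate_point)
    next
      case 2 then show ?thesis using True v(1) by (intro line1')
    next
      case 3 then show ?thesis using True v(1) by (intro line2)
    next
      case 4 then show ?thesis using True v(1) by (intro line3)
    qed
  qed (use v in \<open>intro aff\<close>)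
  then show "zero_locus (hom_cubic c) \<subseteq> projective_closure {z. hom_cubic c (affine_chart 4 z) = 0}"
    unfolding zero_locus_def projective_closure_def by blast
qed

section \<open>The local normal form\<close>

text \<open>In the chart around the singular point the cubic is quadratic in \<open>(x, y)\<close> with coefficients
  depending on the third coordinate \<open>w\<close>. Here \<open>(x\<^sub>0, y\<^sub>0)\<close> is its critical point and
  \<open>h w\<^sup>4\<close> its critical value; \<open>\<alpha> \<beta> = - w\<close> and \<open>\<alpha>\<^sup>2 + \<beta>\<^sup>2 = 1 - w\<close>.\<close>

lemma quadratic_normal_form:
  fixes c w x y r q :: complex
  defines "d \<equiv> (1 - 3 * w) * (1 + w)"
    and "\<alpha> \<equiv> (r + q) / 2" and "\<beta> \<equiv> (r - q) / 2"
  defines "X \<equiv> x + w\<^sup>2 * (1 - w + 2 * c * w) / d" and "Y \<equiv> y + w\<^sup>2 * (2 * w + (1 - w) * c) / d"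
    and "h \<equiv> (c + w * (c\<^sup>2 - c + 1)) / d"
  assumes "r\<^sup>2 = 1 - 3 * w" "q\<^sup>2 = 1 + w" "d \<noteq> 0"
  shows "w * (x\<^sup>2 + x * y + y\<^sup>2) - x * y - w\<^sup>2 * (c * x + y) =
    h * w ^ 4 - (\<alpha> * X + \<beta> * Y) * (\<beta> * X + \<alpha> * Y)"
proof -
  \<comment> \<open>With S = X + Y and D = X - Y the two factors are (r S + q D)/2 and (r S - q
    D)/2, so their product is ((1 - 3w) S^2 - (1 + w) D^2)/4, the diagonalized quadratic part up to
    sign.\<close>
  have "4 * (\<alpha> * \<beta>) = r\<^sup>2 - q\<^sup>2" "2 * (\<alpha>\<^sup>2 + \<beta>\<^sup>2) = r\<^sup>2 + q\<^sup>2"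
    by (simp_all add: \<alpha>_def \<beta>_def field_simps power2_eq_square)
  then have "\<alpha> * \<beta> = - w" "\<alpha>\<^sup>2 + \<beta>\<^sup>2 = 1 - w"
    unfolding assms(7,8) by algebra+
  then have AB: "(\<alpha> * X + \<beta> * Y) * (\<beta> * X + \<alpha> * Y) = - w * (X\<^sup>2 + Y\<^sup>2) + (1 - w) * X * Y"
    by algebra
  \<comment> \<open>Replacing division by \<open>u\<close> makes the claim a polynomial identity
    modulo u d = 1.\<close>
  define u where "u = inverse d"
  have u: "u * ((1 - 3 * w) * (1 + w)) = 1" using assms(9) unfolding u_def d_def by (rule left_inverse)
  have "X = x + w\<^sup>2 * (1 - w + 2 * c * w) * u" "Y = y + w\<^sup>2 * (2 * w + (1 - w) * c) * u"
    "h = (c + w * (c\<^sup>2 - c + 1)) * u"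
    by (simp_all add: X_def Y_def h_def u_def divide_inverse)
  then show ?thesis unfolding AB using u by algebra
qed

text \<open>In this chart the singular point is the origin and \<open>z$3\<close> is the fourth
  homogeneous coordinate w. The hypothesis \<open>c \<noteq> 0\<close> makes \<open>h\<close>
  invertible near w = 0.\<close>

lemma A_singularity_hom_cubic:
  assumes "c \<noteq> 0"
  shows "A_singularity 3 (\<lambda>z. hom_cubic c (affine_chart 3 z)) 0"
proof -
  \<comment> \<open>The real parts keep both square roots holomorphic and \<open>d\<close> nonzero;
    the last condition keeps \<open>h\<close> nonzero. Only \<open>z$3\<close> is restricted, and
    both maps fix it, so \<open>U\<close> serves as source and target.\<close>
  define U :: "(complex^3) set" where
    "U = {z. 0 < Re (1 - 3 * z$3) \<and> 0 < Re (1 + z$3) \<and> c + z$3 * (c\<^sup>2 - c + 1) \<noteq> 0}"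
  define r q d X0 Y0 h where rq: "r = (\<lambda>w. csqrt (1 - 3 * w))" "q = (\<lambda>w. csqrt (1 + w))"
    and d_def: "d = (\<lambda>w. (1 - 3 * w) * (1 + w))"
    and X0_def: "X0 = (\<lambda>w. w\<^sup>2 * (1 - w + 2 * c * w) / d w)"
    and Y0_def: "Y0 = (\<lambda>w. w\<^sup>2 * (2 * w + (1 - w) * c) / d w)"
    and h_def: "h = (\<lambda>w. (c + w * (c\<^sup>2 - c + 1)) / d w)"
  define \<alpha> \<beta> where ab: "\<alpha> = (\<lambda>w. (r w + q w) / 2)" "\<beta> = (\<lambda>w. (r w - q w) / 2)"
  define \<phi> :: "complex^3 \<Rightarrow> complex^3" where "\<phi> = (\<lambda>z. vector
    [(\<alpha> (z$3) * (z$1 + X0 (z$3)) + \<beta> (z$3) * (z$2 + Y0 (z$3))) / h (z$3),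
     \<beta> (z$3) * (z$1 + X0 (z$3)) + \<alpha> (z$3) * (z$2 + Y0 (z$3)), z$3])"
  \<comment> \<open>Cramer's rule for the symmetric matrix with rows (\<alpha>, \<beta>) and
    (\<beta>, \<alpha>), whose determinant is r q.\<close>
  define \<psi> :: "complex^3 \<Rightarrow> complex^3" where "\<psi> = (\<lambda>z. vector
    [(\<alpha> (z$3) * (h (z$3) * z$1) - \<beta> (z$3) * z$2) / (r (z$3) * q (z$3)) - X0 (z$3),
     (\<alpha> (z$3) * z$2 - \<beta> (z$3) * (h (z$3) * z$1)) / (r (z$3) * q (z$3)) - Y0 (z$3), z$3])"
  have nz: "1 - 3 * z$3 \<noteq> 0" "1 + z$3 \<noteq> 0" "d (z$3) \<noteq> 0" "h (z$3) \<noteq> 0" "r (z$3) \<noteq> 0" "q (z$3) \<noteq> 0"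
    if "z \<in> U" for z
  proof -
    have "1 - 3 * z$3 \<noteq> 0" "1 + z$3 \<noteq> 0" "c + z$3 * (c\<^sup>2 - c + 1) \<noteq> 0"
      using that unfolding U_def by force+
    then show "1 - 3 * z$3 \<noteq> 0" "1 + z$3 \<noteq> 0" "d (z$3) \<noteq> 0" "h (z$3) \<noteq> 0" "r (z$3) \<noteq> 0" "q (z$3) \<noteq> 0"
      unfolding d_def h_def rq by simp_all
  qed
  have Re_pos: "0 < Re (1 - 3 * z$3)" "0 < Re (1 + z$3)" if "z \<in> U" for z
    using that unfolding U_def by blast+
  have hol: "holomorphic_fun_on (\<lambda>z. r (z$3)) U" "holomorphic_fun_on (\<lambda>z. q (z$3)) U"
    "holomorphic_fun_on (\<lambda>z. d (z$3)) U"
    unfolding rq d_def by (intro holomorphic_fun_on_intros Re_pos; assumption)+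
  have hol': "holomorphic_fun_on (\<lambda>z. \<alpha> (z$3)) U" "holomorphic_fun_on (\<lambda>z. \<beta> (z$3)) U"
    "holomorphic_fun_on (\<lambda>z. X0 (z$3)) U" "holomorphic_fun_on (\<lambda>z. Y0 (z$3)) U"
    "holomorphic_fun_on (\<lambda>z. h (z$3)) U"
    unfolding ab X0_def Y0_def h_def by (intro holomorphic_fun_on_intros hol nz; simp)+
  have maps: "\<phi> ` U \<subseteq> U" "\<psi> ` U \<subseteq> U" by (auto simp: U_def \<phi>_def \<psi>_def)
  have det: "\<alpha> w * \<alpha> w - \<beta> w * \<beta> w = r w * q w" for w by (simp add: ab field_simps)
  have inv1: "\<psi> (\<phi> z) = z" if "z \<in> U" for z
  proof -
    note n = nz[OF that]
    have "(\<alpha> (z$3) * (\<alpha> (z$3) * X + \<beta> (z$3) * Y) - \<beta> (z$3) * (\<beta> (z$3) * X + \<alpha> (z$3) * Y)) = r (z$3) * q (z$3) * X"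
      "(\<alpha> (z$3) * (\<beta> (z$3) * X + \<alpha> (z$3) * Y) - \<beta> (z$3) * (\<alpha> (z$3) * X + \<beta> (z$3) * Y)) = r (z$3) * q (z$3) * Y"
      for X Y
      unfolding det[symmetric] by algebra+
    then show ?thesis using n by (simp add: \<phi>_def \<psi>_def vec3_eq_iff)
  qed
  have inv2: "\<phi> (\<psi> z) = z" if "z \<in> U" for z
  proof -
    note n = nz[OF that]
    have "\<alpha> (z$3) * ((\<alpha> (z$3) * A - \<beta> (z$3) * B) / (r (z$3) * q (z$3)))
        + \<beta> (z$3) * ((\<alpha> (z$3) * B - \<beta> (z$3) * A) / (r (z$3) * q (z$3))) = A"
      "\<beta> (z$3) * ((\<alpha> (z$3) * A - \<beta> (z$3) * B) / (r (z$3) * q (z$3)))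
        + \<alpha> (z$3) * ((\<alpha> (z$3) * B - \<beta> (z$3) * A) / (r (z$3) * q (z$3))) = B"
      for A B
    proof -
      have "\<alpha> (z$3) * (\<alpha> (z$3) * A - \<beta> (z$3) * B) + \<beta> (z$3) * (\<alpha> (z$3) * B - \<beta> (z$3) * A) = r (z$3) * q (z$3) * A"
        "\<beta> (z$3) * (\<alpha> (z$3) * A - \<beta> (z$3) * B) + \<alpha> (z$3) * (\<alpha> (z$3) * B - \<beta> (z$3) * A) = r (z$3) * q (z$3) * B"
        unfolding det[symmetric] by algebra+
      then show "\<alpha> (z$3) * ((\<alpha> (z$3) * A - \<beta> (z$3) * B) / (r (z$3) * q (z$3)))
        + \<beta> (z$3) * ((\<alpha> (z$3) * B - \<beta> (z$3) * A) / (r (z$3) * q (z$3))) = A"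
        "\<beta> (z$3) * ((\<alpha> (z$3) * A - \<beta> (z$3) * B) / (r (z$3) * q (z$3)))
        + \<alpha> (z$3) * ((\<alpha> (z$3) * B - \<beta> (z$3) * A) / (r (z$3) * q (z$3))) = B"
        using n by (simp_all add: add_divide_distrib[symmetric])
    qed
    then show ?thesis using n by (simp add: \<phi>_def \<psi>_def vec3_eq_iff)
  qed
  have hol_\<phi>: "holomorphic_map_on \<phi> U"
    unfolding holomorphic_map_on_def forall_3 \<phi>_def vector_3
    by (intro conjI holomorphic_fun_on_intros hol hol' nz)
  have hol_\<psi>: "holomorphic_map_on \<psi> U"
    unfolding holomorphic_map_on_def forall_3 \<psi>_def vector_3
    by (intro conjI holomorphic_fun_on_intros hol hol'; simp add: nz)
  have "open U"
    unfolding U_def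
    by (intro open_Collect_conj open_Collect_less open_Collect_neq continuous_intros)
  moreover have "0 \<in> U" using assms by (simp add: U_def)
  moreover have "\<phi> 0 = 0"
    by (simp add: \<phi>_def vec3_eq_iff X0_def Y0_def)
  moreover have "homeomorphism U U \<phi> \<psi>"
    using maps inv1 inv2 hol_\<phi> hol_\<psi>
    by (intro homeomorphismI holomorphic_map_on_imp_continuous_on)
  moreover have "holomorphic_fun_on (\<lambda>z. - h (z$3)) U"
    by (intro holomorphic_fun_on_intros hol')
  moreover have "hom_cubic c (affine_chart 3 z) = - h (z$3) * (\<phi> z $ 1 * \<phi> z $ 2 - (\<phi> z $ 3) ^ 4)"
    if "z \<in> U" for z
  proof -
    note n = nz[OF that]
    have "(r (z$3))\<^sup>2 = 1 - 3 * z$3" "(q (z$3))\<^sup>2 = 1 + z$3" by (simp_all add: rq)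
    note quadratic_normal_form[OF this, of "z$1" "z$2" c]
    moreover have "hom_cubic c (affine_chart 3 z) =
        z$3 * ((z$1)\<^sup>2 + z$1 * z$2 + (z$2)\<^sup>2) - z$1 * z$2 - (z$3)\<^sup>2 * (c * z$1 + z$2)"
      by (simp add: hom_cubic_def affine_chart_def)
    ultimately have "hom_cubic c (affine_chart 3 z) = h (z$3) * (z$3) ^ 4
        - (\<alpha> (z$3) * (z$1 + X0 (z$3)) + \<beta> (z$3) * (z$2 + Y0 (z$3)))
          * (\<beta> (z$3) * (z$1 + X0 (z$3)) + \<alpha> (z$3) * (z$2 + Y0 (z$3)))"
      using n unfolding ab X0_def Y0_def h_def d_def by simp
    moreover have "- k * (A / k * B - C) = k * C - A * B" if "k \<noteq> 0" for k A B C :: complex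
      using that by (simp add: field_simps)
    ultimately show ?thesis using n(4) unfolding \<phi>_def vector_3 by metis
  qed
  ultimately have "locally_analytically_equivalent (\<lambda>z. hom_cubic c (affine_chart 3 z)) 0
      (\<lambda>z. z$1 * z$2 - (z$3) ^ 4) 0"
    unfolding locally_analytically_equivalent_def
    using hol_\<phi> hol_\<psi> nz
    by (intro exI[of _ U] exI[of _ \<phi>] exI[of _ \<psi>] exI[of _ "\<lambda>z. - h (z$3)"]) auto
  then show ?thesis by (simp add: A_singularity_def)
qed

theorem proposition5p1:
  fixes a :: complex
  shows "cubic_surface_of_type_A 3 (projectivization a)"
proof -
  define c where "c = exp (- (of_real pi * a))"
  have c: "c \<noteq> 0" by (simp add: c_def)
  have "affine_chart 3 0 = axis 3 1"
    by (simp add: affine_chart_def vec4_eq_iff axis_def)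
  then have "A_singularity_at 3 (hom_cubic c) (hom_coords (axis 3 1))"
    unfolding A_singularity_at_def using A_singularity_hom_cubic[OF c] by metis
  \<comment> \<open>At infinity only the term - xys survives, with value -1 here.\<close>
  moreover have "hom_cubic c (vector [1, 1, 1, 0]) \<noteq> 0" by (simp add: hom_cubic_def)
  moreover have "projectivization a = zero_locus (hom_cubic c)"
    by (simp add: projectivization_def eliminate_g2_image zero_locus_hom_cubic c_def)
  ultimately show ?thesis
    unfolding cubic_surface_of_type_A_def
    using cubic_form_hom_cubic singular_points_hom_cubic[OF c] by blast
qed

end
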